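(* Let $f(z)\in\mathbb{Q}[[z]]$ be a delta series. Define symmetric functions $r_n(X)$ and $c_n(X)$ by $$\prod_{x\in X}\frac{1}{1-f(z)x}=\sum_{n\ge0}r_n(X)z^n,\qquad \prod_{x\in X}\bigl(1-f(-z)x\bigr)=\sum_{n\ge0}c_n(X)z^n ,$$ and for every partition $\lambda$ let $P_\lambda(X)=\det\bigl(r_{\lambda_i+j-i}(X)\bigr)$. Then for every partition $\lambda$ with conjugate $\lambda'$, $$P_\lambda(X)=\det\bigl(c_{\lambda'_i+j-i}(X)\bigr).$$
   Context: A delta series is a formal power series that is invertible with respect to composition (zero constant term, nonzero linear coefficient). Symmetric functions are over $\mathbb{Q}$ in infinitely many variables $X=\{x_1,x_2,\dots\}$. By convention $r_n=c_n=0$ for $n<0$ (and $r_0=c_0=1$). The first determinant has size $n\times n$ for any $n$ at least the number of nonzero parts of $\lambda$, the second has size $m\times m$ for any $m$ at least the number of nonzero parts of $\lambda'$; the values do not depend on $n$, $m$. *)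

theory Defs
  imports
    "HOL-Library.Multiset"
    "HOL-Computational_Algebra.Formal_Power_Series"
    "Jordan_Normal_Form.Determinant"
begin

section \<open>Power series in infinitely many variables\<close>

text \<open>
  The variables are indexed by \<open>nat\<close>, and a monomial is the multiset of the indices of the
  variables occurring in it, so that the product of monomials is \<open>+\<close>, the total degree is
  \<open>size\<close>, and the \<open>j\<close>-th power of the \<open>i\<close>-th variable is \<open>replicate_mset j i\<close>.
\<close>

typedef 'a mps = "UNIV :: (nat multiset \<Rightarrow> 'a) set"
  morphisms mps_coeff Mps ..

setup_lifting type_definition_mps

lemma mps_eqI: "(\<And>m. mps_coeff p m = mps_coeff q m) \<Longrightarrow> p = q"
  by transfer auto

lemma mps_coeff_Mps [simp]: "mps_coeff (Mps g) m = g m"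
  by (simp add: Mps_inverse)

definition monomial_splits :: "nat multiset \<Rightarrow> (nat multiset \<times> nat multiset) set" where
  "monomial_splits m = {(a, b). a + b = m}"

lemma finite_submultisets: "finite {a. a \<subseteq># (m :: 'b multiset)}"
proof (induction m)
  case empty
  then show ?case by simp
next
  case (add x m)
  have "{a. a \<subseteq># add_mset x m} \<subseteq> {a. a \<subseteq># m} \<union> add_mset x ` {a. a \<subseteq># m}"
  proof
    fix a assume "a \<in> {a. a \<subseteq># add_mset x m}"
    then have a: "a \<subseteq># add_mset x m" by simp
    show "a \<in> {a. a \<subseteq># m} \<union> add_mset x ` {a. a \<subseteq># m}"
    proof (cases "x \<in># a")
      case True
      then obtain b where "a = add_mset x b" by (metis insert_DiffM)
      with a show ?thesis by auto
    next
      case False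
      with a have "a \<subseteq># m" by (metis diff_single_trivial subset_eq_diff_conv
            add_mset_add_single add.commute)
      then show ?thesis by simp
    qed
  qed
  with add show ?case by (meson finite_UnI finite_imageI finite_subset)
qed

lemma finite_monomial_splits [simp]: "finite (monomial_splits m)"
proof (rule finite_subset)
  show "monomial_splits m \<subseteq> {a. a \<subseteq># m} \<times> {a. a \<subseteq># m}"
    by (auto simp: monomial_splits_def)
qed (simp add: finite_submultisets)

lemma monomial_splits_empty [simp]: "monomial_splits {#} = {({#}, {#})}"
  by (auto simp: monomial_splits_def)

lemma sum_monomial_splits_single:
  fixes h :: "nat multiset \<Rightarrow> nat multiset \<Rightarrow> 'a :: comm_monoid_add"
  assumes "u + v = m" and "\<And>a b. a + b = m \<Longrightarrow> a \<noteq> u \<Longrightarrow> h a b = 0"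
  shows "(\<Sum>(a, b)\<in>monomial_splits m. h a b) = h u v"
proof -
  have "(\<Sum>(a, b)\<in>monomial_splits m. h a b) = (\<Sum>(a, b)\<in>{(u, v)}. h a b)"
  proof (rule sum.mono_neutral_right)
    show "{(u, v)} \<subseteq> monomial_splits m"
      using assms(1) by (simp add: monomial_splits_def)
    have "h a b = 0" if "a + b = m" "(a, b) \<noteq> (u, v)" for a b
    proof -
      have "a \<noteq> u" using that assms(1) by auto
      with that show ?thesis using assms(2) by blast
    qed
    then show "\<forall>w\<in>monomial_splits m - {(u, v)}. (case w of (a, b) \<Rightarrow> h a b) = 0"
      by (auto simp: monomial_splits_def)
  qed simp
  then show ?thesis by simp
qed

instantiation mps :: (comm_ring_1) comm_ring_1
begin

lift_definition zero_mps :: "'a mps" is "\<lambda>_. 0" .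
lift_definition one_mps :: "'a mps" is "\<lambda>m. if m = {#} then 1 else 0" .
lift_definition plus_mps :: "'a mps \<Rightarrow> 'a mps \<Rightarrow> 'a mps" is "\<lambda>p q m. p m + q m" .
lift_definition minus_mps :: "'a mps \<Rightarrow> 'a mps \<Rightarrow> 'a mps" is "\<lambda>p q m. p m - q m" .
lift_definition uminus_mps :: "'a mps \<Rightarrow> 'a mps" is "\<lambda>p m. - p m" .
lift_definition times_mps :: "'a mps \<Rightarrow> 'a mps \<Rightarrow> 'a mps" is
  "\<lambda>p q m. \<Sum>(a, b)\<in>monomial_splits m. p a * q b" .

instance
proof
  fix p q r :: "'a mps"
  show "p * q * r = p * (q * r)"
  proof (transfer, rule ext)
    fix p q r :: "nat multiset \<Rightarrow> 'a" and m
    have "(\<Sum>(u, c)\<in>monomial_splits m. (\<Sum>(a, b)\<in>monomial_splits u. p a * q b) * r c) =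
      (\<Sum>(x, y)\<in>Sigma (monomial_splits m) (\<lambda>x. monomial_splits (fst x)).
        p (fst y) * q (snd y) * r (snd x))"
      by (subst sum.Sigma [symmetric])
        (auto simp: sum_distrib_right case_prod_beta intro!: sum.cong)
    also have "\<dots> = (\<Sum>(x, y)\<in>Sigma (monomial_splits m) (\<lambda>x. monomial_splits (snd x)).
        p (fst x) * (q (fst y) * r (snd y)))"
      by (rule sum.reindex_bij_witness
          [where i = "\<lambda>((a, u), (b, c)). ((a + b, c), (a, b))"
            and j = "\<lambda>((u, c), (a, b)). ((a, b + c), (b, c))"])
        (auto simp: monomial_splits_def ac_simps)
    also have "\<dots> = (\<Sum>(a, u)\<in>monomial_splits m. p a * (\<Sum>(b, c)\<in>monomial_splits u. q b * r c))"
      by (subst sum.Sigma [symmetric])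
        (auto simp: sum_distrib_left case_prod_beta intro!: sum.cong)
    finally show "(\<Sum>(u, c)\<in>monomial_splits m. (\<Sum>(a, b)\<in>monomial_splits u. p a * q b) * r c) =
      (\<Sum>(a, u)\<in>monomial_splits m. p a * (\<Sum>(b, c)\<in>monomial_splits u. q b * r c))" .
  qed
  show "p * q = q * p"
  proof (transfer, rule ext)
    fix p q :: "nat multiset \<Rightarrow> 'a" and m
    show "(\<Sum>(a, b)\<in>monomial_splits m. p a * q b) = (\<Sum>(a, b)\<in>monomial_splits m. q a * p b)"
      by (rule sum.reindex_bij_witness [where i = prod.swap and j = prod.swap])
        (auto simp: monomial_splits_def ac_simps)
  qed
  show "1 * p = p"
  proof (transfer, rule ext)
    fix p :: "nat multiset \<Rightarrow> 'a" and m
    show "(\<Sum>(a, b)\<in>monomial_splits m. (if a = {#} then 1 else 0) * p b) = p m"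
      by (subst sum_monomial_splits_single [where u = "{#}" and v = m]) auto
  qed
  show "(p + q) * r = p * r + q * r"
    by transfer (auto simp: sum.distrib [symmetric] algebra_simps case_prod_beta intro!: ext sum.cong)
  show "(0 :: 'a mps) \<noteq> 1"
    by transfer (metis zero_neq_one)
qed (transfer; auto)+

end

lemma mps_coeff_0 [simp]: "mps_coeff 0 m = 0"
  and mps_coeff_1: "mps_coeff 1 m = (if m = {#} then 1 else 0)"
  and mps_coeff_add [simp]: "mps_coeff (p + q) m = mps_coeff p m + mps_coeff q m"
  and mps_coeff_diff [simp]: "mps_coeff (p - q) m = mps_coeff p m - mps_coeff q m"
  and mps_coeff_uminus [simp]: "mps_coeff (- p) m = - mps_coeff p m"
  and mps_coeff_mult: "mps_coeff (p * q) m =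
    (\<Sum>(a, b)\<in>monomial_splits m. mps_coeff p a * mps_coeff q b)"
  for p q :: "'a :: comm_ring_1 mps"
  by (transfer; simp)+

lemma mps_coeff_sum [simp]: "mps_coeff (sum h A) m = (\<Sum>x\<in>A. mps_coeff (h x) m)"
  by (induction A rule: infinite_finite_induct) auto

definition mps_const :: "'a \<Rightarrow> 'a :: comm_ring_1 mps" where
  "mps_const c = Mps (\<lambda>m. if m = {#} then c else 0)"

definition mps_var :: "nat \<Rightarrow> 'a :: comm_ring_1 mps" where
  "mps_var i = Mps (\<lambda>m. if m = {#i#} then 1 else 0)"

lemma mps_coeff_const_mult [simp]: "mps_coeff (mps_const c * p) m = c * mps_coeff p m"
  unfolding mps_coeff_mult
  by (subst sum_monomial_splits_single [where u = "{#}" and v = m]) (auto simp: mps_const_def)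

lemma mps_coeff_var_mult:
  "mps_coeff (mps_var i * p) m = (if i \<in># m then mps_coeff p (m - {#i#}) else 0)"
proof (cases "i \<in># m")
  case True
  have "mps_coeff (mps_var i * p) m = mps_coeff (mps_var i) {#i#} * mps_coeff p (m - {#i#})"
    unfolding mps_coeff_mult using True
    by (intro sum_monomial_splits_single) (auto simp: mps_var_def)
  with True show ?thesis by (simp add: mps_var_def)
next
  case False
  then have "mps_coeff (mps_var i) a * mps_coeff p b = 0" if "(a, b) \<in> monomial_splits m" for a b
    using that by (auto simp: monomial_splits_def mps_var_def)
  with False show ?thesis
    unfolding mps_coeff_mult by (auto intro!: sum.neutral)
qed


section \<open>The ring of symmetric functions over the rationals\<close>

definition symmetric_function :: "rat mps \<Rightarrow> bool" where
  "symmetric_function p \<longleftrightarrow>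
     (\<forall>\<sigma> m. bij \<sigma> \<longrightarrow> mps_coeff p (image_mset \<sigma> m) = mps_coeff p m) \<and>
     (\<exists>d. \<forall>m. mps_coeff p m \<noteq> 0 \<longrightarrow> size m \<le> d)"

lemma image_mset_eq_plus_bij:
  assumes "bij \<sigma>" "a + b = image_mset \<sigma> m"
  shows "image_mset (inv_into UNIV \<sigma>) a + image_mset (inv_into UNIV \<sigma>) b = m"
proof -
  have "image_mset (inv_into UNIV \<sigma>) a + image_mset (inv_into UNIV \<sigma>) b = image_mset (inv_into UNIV \<sigma> \<circ> \<sigma>) m"
    by (metis assms(2) image_mset_union multiset.map_comp)
  then show ?thesis
    using assms(1) by (simp add: bij_is_inj)
qed

lemma image_mset_inv_bij [simp]: "bij \<sigma> \<Longrightarrow> image_mset \<sigma> (image_mset (inv_into UNIV \<sigma>) m) = m"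
  by (simp add: multiset.map_comp bij_is_surj surj_iff [symmetric] surj_f_inv_f comp_def)

lemma image_mset_bij_inv [simp]: "bij \<sigma> \<Longrightarrow> image_mset (inv_into UNIV \<sigma>) (image_mset \<sigma> m) = m"
  by (simp add: multiset.map_comp bij_is_inj inv_f_f comp_def)

lemma mps_coeff_mult_image:
  assumes "bij \<sigma>"
  shows "mps_coeff (p * q) (image_mset \<sigma> m) =
    (\<Sum>(a, b)\<in>monomial_splits m. mps_coeff p (image_mset \<sigma> a) * mps_coeff q (image_mset \<sigma> b))"
  unfolding mps_coeff_mult using assms
  by (intro sum.reindex_bij_witness
      [where i = "\<lambda>(a, b). (image_mset \<sigma> a, image_mset \<sigma> b)"
        and j = "\<lambda>(a, b). (image_mset (inv_into UNIV \<sigma>) a, image_mset (inv_into UNIV \<sigma>) b)"])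
    (auto simp: monomial_splits_def image_mset_eq_plus_bij)

lemma symmetric_function_mult:
  assumes "symmetric_function p" "symmetric_function q"
  shows "symmetric_function (p * q)"
proof -
  obtain d e where d: "\<And>m. mps_coeff p m \<noteq> 0 \<Longrightarrow> size m \<le> d"
    and e: "\<And>m. mps_coeff q m \<noteq> 0 \<Longrightarrow> size m \<le> e"
    using assms unfolding symmetric_function_def by metis
  have "size m \<le> d + e" if "mps_coeff (p * q) m \<noteq> 0" for m
  proof -
    from that obtain w where "w \<in> monomial_splits m"
        "(case w of (a, b) \<Rightarrow> mps_coeff p a * mps_coeff q b) \<noteq> 0"
      unfolding mps_coeff_mult by (rule sum.not_neutral_contains_not_neutral)
    then obtain a b where "(a, b) \<in> monomial_splits m" "mps_coeff p a * mps_coeff q b \<noteq> 0"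
      by (cases w) auto
    then have "m = a + b" "size a \<le> d" "size b \<le> e"
      using d e by (auto simp: monomial_splits_def)
    then show ?thesis by simp
  qed
  moreover have "mps_coeff (p * q) (image_mset \<sigma> m) = mps_coeff (p * q) m" if "bij \<sigma>" for \<sigma> m
    using assms that unfolding mps_coeff_mult_image [OF that] mps_coeff_mult [of p q m]
    by (simp add: symmetric_function_def)
  ultimately show ?thesis
    unfolding symmetric_function_def by blast
qed

lemma symmetric_function_0: "symmetric_function 0"
  and symmetric_function_1: "symmetric_function 1"
  and symmetric_function_uminus: "symmetric_function p \<Longrightarrow> symmetric_function (- p)"
  by (auto simp: symmetric_function_def mps_coeff_1)

lemma symmetric_function_add:
  assumes "symmetric_function p" "symmetric_function q"
  shows "symmetric_function (p + q)"
proof -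
  obtain d e where d: "\<And>m. mps_coeff p m \<noteq> 0 \<Longrightarrow> size m \<le> d"
    and e: "\<And>m. mps_coeff q m \<noteq> 0 \<Longrightarrow> size m \<le> e"
    using assms unfolding symmetric_function_def by metis
  have "size m \<le> d + e" if "mps_coeff (p + q) m \<noteq> 0" for m
    using that d[of m] e[of m] by (cases "mps_coeff p m = 0") auto
  then show ?thesis
    using assms unfolding symmetric_function_def by (metis mps_coeff_add)
qed

lemma symmetric_function_diff:
  "symmetric_function p \<Longrightarrow> symmetric_function q \<Longrightarrow> symmetric_function (p - q)"
  using symmetric_function_add [of p "- q"] symmetric_function_uminus [of q] by simp

typedef symfun = "{p. symmetric_function p}"
  morphisms mps_of_symfun Symfun
  using symmetric_function_0 by blast

setup_lifting type_definition_symfun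

instantiation symfun :: comm_ring_1
begin

lift_definition zero_symfun :: symfun is 0 by (rule symmetric_function_0)
lift_definition one_symfun :: symfun is 1 by (rule symmetric_function_1)
lift_definition plus_symfun :: "symfun \<Rightarrow> symfun \<Rightarrow> symfun" is "(+)"
  by (rule symmetric_function_add)
lift_definition minus_symfun :: "symfun \<Rightarrow> symfun \<Rightarrow> symfun" is "(-)"
  by (rule symmetric_function_diff)
lift_definition uminus_symfun :: "symfun \<Rightarrow> symfun" is uminus
  by (rule symmetric_function_uminus)
lift_definition times_symfun :: "symfun \<Rightarrow> symfun \<Rightarrow> symfun" is "(*)"
  by (rule symmetric_function_mult)

instance
  by standard (transfer; simp add: algebra_simps)+

end


section \<open>Generating functions\<close>

definition delta_series :: "rat fps \<Rightarrow> bool" where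
  "delta_series f \<longleftrightarrow> fps_nth f 0 = 0 \<and> fps_nth f 1 \<noteq> 0"

lemma delta_series_iff_invertible:
  "delta_series f \<longleftrightarrow>
    fps_nth f 0 = 0 \<and> (\<exists>g. fps_nth g 0 = 0 \<and> f oo g = fps_X \<and> g oo f = fps_X)"
proof
  assume f: "delta_series f"
  have "fps_nth (fps_inv f) 0 = 0"
    by (simp add: fps_inv_def)
  with f show "fps_nth f 0 = 0 \<and> (\<exists>g. fps_nth g 0 = 0 \<and> f oo g = fps_X \<and> g oo f = fps_X)"
    unfolding delta_series_def using fps_inv fps_inv_right by blast
next
  assume "fps_nth f 0 = 0 \<and> (\<exists>g. fps_nth g 0 = 0 \<and> f oo g = fps_X \<and> g oo f = fps_X)"
  then obtain g where f0: "fps_nth f 0 = 0" and "f oo g = fps_X" by blast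
  then have "fps_nth (f oo g) 1 = 1" by simp
  then have "fps_nth f 1 \<noteq> 0" by (auto simp: fps_compose_nth)
  with f0 show "delta_series f" by (simp add: delta_series_def)
qed

definition mps_fps_of_fps :: "rat fps \<Rightarrow> rat mps fps" where
  "mps_fps_of_fps f = Abs_fps (\<lambda>n. mps_const (fps_nth f n))"

definition mps_fps_of_symfuns :: "(nat \<Rightarrow> symfun) \<Rightarrow> rat mps fps" where
  "mps_fps_of_symfuns a = Abs_fps (\<lambda>n. mps_of_symfun (a n))"

text \<open>
  \<open>1 - f(z) x\<^sub>i\<close> as a power series in \<open>z\<close> over the ring of power series in the variables.
\<close>

definition linear_factor :: "rat fps \<Rightarrow> nat \<Rightarrow> rat mps fps" where
  "linear_factor f i = 1 - mps_fps_of_fps f * fps_const (mps_var i)"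

text \<open>
  The coefficient ring is not a field, so \<open>inverse\<close> is not available. The library's
  \<open>fps_right_inverse u y\<close> is the inverse of \<open>u\<close> whenever \<open>y\<close> is an inverse of the constant
  coefficient of \<open>u\<close>; here that coefficient is \<open>1\<close> if \<open>f\<close> has zero constant term.
\<close>

definition inv_linear_factor :: "rat fps \<Rightarrow> nat \<Rightarrow> rat mps fps" where
  "inv_linear_factor f i = fps_right_inverse (linear_factor f i) 1"

lemma mps_const_0 [simp]: "mps_const 0 = 0"
  by (rule mps_eqI) (simp add: mps_const_def)

lemma linear_factor_mult_inv:
  assumes "fps_nth f 0 = 0"
  shows "linear_factor f i * inv_linear_factor f i = 1"
  unfolding inv_linear_factor_def
  by (rule fps_right_inverse) (simp add: linear_factor_def mps_fps_of_fps_def assms)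

text \<open>
  Convergence of an infinite product over all variables, for the product of the discrete
  topologies on the coefficients: for every power of \<open>z\<close> and every monomial, the coefficient in
  the finite subproducts is eventually constant. The topology that the library puts on \<open>fps\<close>
  is too fine here, since it looks at the powers of \<open>z\<close> only.
\<close>

definition has_formal_prod :: "(nat \<Rightarrow> rat mps fps) \<Rightarrow> rat mps fps \<Rightarrow> bool" where
  "has_formal_prod F P \<longleftrightarrow>
     (\<forall>n m. \<forall>\<^sub>F I in finite_subsets_at_top UNIV.
        mps_coeff (fps_nth (\<Prod>i\<in>I. F i) n) m = mps_coeff (fps_nth P n) m)"

definition is_r_family :: "rat fps \<Rightarrow> (nat \<Rightarrow> symfun) \<Rightarrow> bool" where
  "is_r_family f r \<longleftrightarrow> has_formal_prod (inv_linear_factor f) (mps_fps_of_symfuns r)"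

text \<open>\<open>f oo - fps_X\<close> is \<open>f(-z)\<close>.\<close>

definition is_c_family :: "rat fps \<Rightarrow> (nat \<Rightarrow> symfun) \<Rightarrow> bool" where
  "is_c_family f c \<longleftrightarrow> has_formal_prod (linear_factor (f oo - fps_X)) (mps_fps_of_symfuns c)"


subsection \<open>Existence and uniqueness of the two families\<close>

lemma has_formal_prod_unique:
  assumes "has_formal_prod F P" "has_formal_prod F Q"
  shows "P = Q"
proof (rule fps_ext, rule mps_eqI)
  fix n m
  have "\<forall>\<^sub>F I in finite_subsets_at_top (UNIV :: nat set).
      mps_coeff (fps_nth P n) m = mps_coeff (fps_nth Q n) m"
    using assms(1) [unfolded has_formal_prod_def, rule_format, of n m]
      assms(2) [unfolded has_formal_prod_def, rule_format, of n m]
    by eventually_elim simp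
  then show "mps_coeff (fps_nth P n) m = mps_coeff (fps_nth Q n) m"
    by (simp add: eventually_const_iff)
qed

lemma mps_fps_of_symfuns_inject: "mps_fps_of_symfuns a = mps_fps_of_symfuns b \<Longrightarrow> a = b"
  by (auto simp: mps_fps_of_symfuns_def fps_eq_iff mps_of_symfun_inject)

text \<open>
  The \<open>i\<close>-th factor is the same series, with coefficients \<open>b\<close>, in \<open>z\<close> and the \<open>i\<close>-th variable.
\<close>

context
  fixes b :: "nat \<Rightarrow> nat \<Rightarrow> rat" and F :: "nat \<Rightarrow> rat mps fps"
  assumes F: "\<And>i k m. mps_coeff (fps_nth (F i) k) m =
      (if m = replicate_mset (size m) i then b k (size m) else 0)"
    and b0: "\<And>k. b k 0 = (if k = 0 then 1 else 0)"
    and b_gt: "\<And>k j. k < j \<Longrightarrow> b k j = 0"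
begin

lemma coeff_factor_mult:
  assumes "i \<notin># m"
  shows "mps_coeff (fps_nth (F i) k * s) m = (if k = 0 then mps_coeff s m else 0)"
proof -
  have 1: "mps_coeff (fps_nth (F i) k) u = 0" if "u + v = m" "u \<noteq> {#}" for u v
  proof -
    have "u \<noteq> replicate_mset (size u) i"
    proof
      assume "u = replicate_mset (size u) i"
      moreover have "size u > 0" using that by (simp add: nonempty_has_size)
      ultimately have "i \<in># u" by (metis in_replicate_mset)
      with assms that show False by auto
    qed
    then show ?thesis by (simp add: F)
  qed
  have "mps_coeff (fps_nth (F i) k * s) m = mps_coeff (fps_nth (F i) k) {#} * mps_coeff s m"
    unfolding mps_coeff_mult using 1 by (intro sum_monomial_splits_single) auto
  then show ?thesis by (simp add: F b0)
qed

lemma coeff_prod_superset: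
  assumes "finite J" "J \<inter> set_mset m = {}"
  shows "mps_coeff (fps_nth (prod F J * G) n) m = mps_coeff (fps_nth G n) m"
  using assms
proof (induction J arbitrary: G n rule: finite_induct)
  case empty
  then show ?case by simp
next
  case (insert i J)
  have "mps_coeff (fps_nth (prod F (insert i J) * G) n) m =
      mps_coeff (fps_nth (F i * (prod F J * G)) n) m"
    using insert by (simp add: mult.assoc)
  also have "\<dots> = (\<Sum>k=0..n. if k = 0 then mps_coeff (fps_nth (prod F J * G) (n - k)) m else 0)"
    using insert.prems by (subst fps_mult_nth) (auto simp: coeff_factor_mult intro!: sum.cong)
  also have "\<dots> = mps_coeff (fps_nth (prod F J * G) n) m"
    by simp
  finally show ?case using insert by simp
qed

lemma size_le_of_coeff_prod:
  assumes "finite S" "mps_coeff (fps_nth (prod F S) n) m \<noteq> 0"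
  shows "size m \<le> n"
  using assms
proof (induction S arbitrary: n m rule: finite_induct)
  case empty
  then show ?case by (auto simp: mps_coeff_1 split: if_splits)
next
  case (insert i S)
  have "(\<Sum>k=0..n. \<Sum>(u, v)\<in>monomial_splits m.
      mps_coeff (fps_nth (F i) k) u * mps_coeff (fps_nth (prod F S) (n - k)) v) \<noteq> 0"
    using insert by (simp add: fps_mult_nth mps_coeff_mult)
  then obtain k where k: "k \<le> n" and "(\<Sum>(u, v)\<in>monomial_splits m.
      mps_coeff (fps_nth (F i) k) u * mps_coeff (fps_nth (prod F S) (n - k)) v) \<noteq> 0"
    by (metis (no_types, lifting) atLeastAtMost_iff sum.not_neutral_contains_not_neutral)
  then obtain w where "w \<in> monomial_splits m" and
    nz: "(case w of (u, v) \<Rightarrow>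
      mps_coeff (fps_nth (F i) k) u * mps_coeff (fps_nth (prod F S) (n - k)) v) \<noteq> 0"
    by (metis (no_types, lifting) sum.not_neutral_contains_not_neutral)
  then obtain u v where w: "w = (u, v)" "u + v = m"
    by (cases w) (auto simp: monomial_splits_def)
  have "size v \<le> n - k"
    using insert.IH nz w by simp
  moreover have "size u \<le> k"
    using nz w b_gt [of k "size u"] by (auto simp: F split: if_splits) (meson not_le)
  ultimately show ?case using k w by auto
qed

lemma coeff_factor_image:
  assumes "bij \<sigma>"
  shows "mps_coeff (fps_nth (F (\<sigma> i)) k) (image_mset \<sigma> m) = mps_coeff (fps_nth (F i) k) m"
proof -
  have "image_mset \<sigma> m = replicate_mset (size m) (\<sigma> i) \<longleftrightarrow> m = replicate_mset (size m) i"
    by (metis assms image_mset_bij_inv image_replicate_mset)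
  then show ?thesis by (simp add: F)
qed

lemma coeff_prod_image:
  assumes "bij \<sigma>" "finite S"
  shows "mps_coeff (fps_nth (\<Prod>i\<in>S. F (\<sigma> i)) n) (image_mset \<sigma> m) =
    mps_coeff (fps_nth (prod F S) n) m"
  using assms(2)
proof (induction S arbitrary: n m rule: finite_induct)
  case empty
  then show ?case by (simp add: mps_coeff_1)
next
  case (insert i S)
  then show ?case
    by (simp add: fps_mult_nth mps_coeff_mult_image [OF assms(1)] coeff_factor_image [OF assms(1)])
      (simp add: mps_coeff_mult)
qed

lemma ex_formal_prod: "\<exists>r. has_formal_prod F (mps_fps_of_symfuns r)"
proof -
  define P where "P n = Mps (\<lambda>m. mps_coeff (fps_nth (prod F (set_mset m)) n) m)" for n
  have sym: "symmetric_function (P n)" for n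
    unfolding symmetric_function_def
  proof (intro conjI exI allI impI)
    fix \<sigma> :: "nat \<Rightarrow> nat" and m
    assume \<sigma>: "bij \<sigma>"
    then have "inj_on \<sigma> (set_mset m)" using bij_is_inj inj_on_subset by blast
    then show "mps_coeff (P n) (image_mset \<sigma> m) = mps_coeff (P n) m"
      by (simp add: P_def prod.reindex coeff_prod_image [OF \<sigma>])
  next
    fix m
    assume "mps_coeff (P n) m \<noteq> 0"
    then show "size m \<le> n"
      using size_le_of_coeff_prod [of "set_mset m" n m] by (simp add: P_def)
  qed
  have "has_formal_prod F (mps_fps_of_symfuns (\<lambda>n. Symfun (P n)))"
    unfolding has_formal_prod_def
  proof (intro allI)
    fix n m
    have "mps_coeff (fps_nth (prod F I) n) m = mps_coeff (P n) m"
      if I: "finite I" "set_mset m \<subseteq> I" for I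
    proof -
      have "prod F I = prod F (I - set_mset m) * prod F (set_mset m)"
        using I by (metis prod.subset_diff)
      moreover have "mps_coeff (fps_nth (prod F (I - set_mset m) * prod F (set_mset m)) n) m =
          mps_coeff (fps_nth (prod F (set_mset m)) n) m"
        using I by (intro coeff_prod_superset) auto
      ultimately show ?thesis by (simp add: P_def)
    qed
    then show "\<forall>\<^sub>F I in finite_subsets_at_top UNIV. mps_coeff (fps_nth (prod F I) n) m =
        mps_coeff (fps_nth (mps_fps_of_symfuns (\<lambda>n. Symfun (P n))) n) m"
      unfolding eventually_finite_subsets_at_top
      by (intro exI [of _ "set_mset m"]) (simp add: mps_fps_of_symfuns_def Symfun_inverse sym)
  qed
  then show ?thesis by blast
qed

end

lemma linear_factor_coeff:
  assumes "fps_nth f 0 = 0"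
  shows "mps_coeff (fps_nth (linear_factor f i) k) m =
    (if m = replicate_mset (size m) i
     then (if size m = 0 then if k = 0 then 1 else 0 else if size m = 1 then - fps_nth f k else 0)
     else 0)"
proof -
  have "mps_coeff (fps_nth (linear_factor f i) k) m =
      (if k = 0 \<and> m = {#} then 1 else 0) - (if m = {#i#} then fps_nth f k else 0)"
    by (auto simp: linear_factor_def mps_fps_of_fps_def mps_coeff_1) (auto simp: mps_var_def)
  also have "m = {#i#} \<longleftrightarrow> m = replicate_mset (size m) i \<and> size m = 1"
    by (metis One_nat_def replicate_mset_0 replicate_mset_Suc size_single)
  finally show ?thesis by auto
qed

lemma inv_linear_factor_coeff:
  assumes "fps_nth f 0 = 0"
  shows "mps_coeff (fps_nth (inv_linear_factor f i) k) m =
    (if m = replicate_mset (size m) i then fps_nth (f ^ size m) k else 0)"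
proof -
  define G where "G = Abs_fps (\<lambda>k. Mps (\<lambda>m.
    if m = replicate_mset (size m) i then fps_nth (f ^ size m) k else 0))"
  have "G = 1 + mps_fps_of_fps f * fps_const (mps_var i) * G"
  proof (rule fps_ext, rule mps_eqI)
    fix k m
    have *: "mps_fps_of_fps f * fps_const (mps_var i) * G =
        mps_fps_of_fps f * (fps_const (mps_var i) * G)"
      by (simp add: mult.assoc)
    have "mps_coeff (fps_nth (1 + mps_fps_of_fps f * fps_const (mps_var i) * G) k) m =
        (if k = 0 \<and> m = {#} then 1 else 0) +
        (\<Sum>l=0..k. fps_nth f l * (if i \<in># m then mps_coeff (fps_nth G (k - l)) (m - {#i#}) else 0))"
      unfolding * fps_add_nth fps_mult_nth [of "mps_fps_of_fps f"]
      by (simp add: mps_fps_of_fps_def mps_coeff_var_mult mps_coeff_1)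
    also have "\<dots> = mps_coeff (fps_nth G k) m"
    proof (cases "i \<in># m")
      case False
      then have "m = replicate_mset (size m) i \<longleftrightarrow> m = {#}"
        by (metis in_replicate_mset nonempty_has_size replicate_mset_0 size_empty)
      with False show ?thesis by (auto simp: G_def)
    next
      case True
      then obtain m' where m: "m = add_mset i m'" by (metis insert_DiffM)
      show ?thesis
        by (auto simp: m G_def fps_mult_nth)
    qed
    finally show "mps_coeff (fps_nth G k) m =
        mps_coeff (fps_nth (1 + mps_fps_of_fps f * fps_const (mps_var i) * G) k) m" ..
  qed
  then have 1: "linear_factor f i * G = 1"
    by (simp add: linear_factor_def algebra_simps)
  have "G = (linear_factor f i * inv_linear_factor f i) * G"
    by (simp add: linear_factor_mult_inv assms)
  also have "\<dots> = inv_linear_factor f i * (linear_factor f i * G)"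
    by (simp add: ac_simps)
  finally have "inv_linear_factor f i = G"
    by (simp add: 1)
  then show ?thesis by (simp add: G_def)
qed

lemma ex1_r_family:
  assumes "delta_series f"
  shows "\<exists>!r. is_r_family f r"
proof -
  have f0: "fps_nth f 0 = 0" using assms by (simp add: delta_series_def)
  have "\<exists>r. has_formal_prod (inv_linear_factor f) (mps_fps_of_symfuns r)"
    by (rule ex_formal_prod [OF inv_linear_factor_coeff [OF f0]])
      (auto simp: f0 startsby_zero_power_prefix)
  then show ?thesis
    unfolding is_r_family_def using has_formal_prod_unique mps_fps_of_symfuns_inject by blast
qed

lemma ex1_c_family:
  assumes "delta_series f"
  shows "\<exists>!c. is_c_family f c"
proof -
  have f0: "fps_nth (f oo - fps_X) 0 = 0" using assms by (simp add: delta_series_def)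
  have "\<exists>c. has_formal_prod (linear_factor (f oo - fps_X)) (mps_fps_of_symfuns c)"
    by (rule ex_formal_prod [OF linear_factor_coeff [OF f0]]) (use f0 in auto)
  then show ?thesis
    unfolding is_c_family_def using has_formal_prod_unique mps_fps_of_symfuns_inject by blast
qed


section \<open>Partitions and Jacobi-Trudi determinants\<close>

text \<open>
  A partition is its sequence of parts, padded with zeros; the parts are indexed from \<open>0\<close>.
\<close>

definition is_partition :: "(nat \<Rightarrow> nat) \<Rightarrow> bool" where
  "is_partition l \<longleftrightarrow> antimono l \<and> finite {i. l i \<noteq> 0}"

definition num_parts :: "(nat \<Rightarrow> nat) \<Rightarrow> nat" where
  "num_parts l = card {i. l i \<noteq> 0}"

definition conjugate_partition :: "(nat \<Rightarrow> nat) \<Rightarrow> nat \<Rightarrow> nat" where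
  "conjugate_partition l j = card {i. j < l i}"

definition extend_by_zero :: "(nat \<Rightarrow> 'a :: zero) \<Rightarrow> int \<Rightarrow> 'a" where
  "extend_by_zero a k = (if k < 0 then 0 else a (nat k))"

definition jacobi_trudi :: "(nat \<Rightarrow> 'a :: comm_ring_1) \<Rightarrow> (nat \<Rightarrow> nat) \<Rightarrow> nat \<Rightarrow> 'a" where
  "jacobi_trudi a l n =
     det (mat n n (\<lambda>(i, j). extend_by_zero a (int (l i) + int j - int i)))"

end

theory Submission
  imports Defs
begin

text \<open>
  Write \<open>R(z)\<close> and \<open>C(z)\<close> for the generating functions of the two families. Replacing \<open>z\<close> by \<open>-z\<close>
  in the product that defines \<open>C\<close> gives \<open>C(-z)\<close> as the product of the factors \<open>1 - f(z) x\<^sub>i\<close>, which are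
  the inverses of the factors of \<open>R\<close>. Hence \<open>R(z) C(-z) = 1\<close> (\<open>generating_functions_mult\<close>), which
  in coefficients is the convolution identity \<open>sum_r_family_c_family\<close>. Together with \<open>c\<^sub>0 = 1\<close> this is all
  that is needed about the families: \<open>jacobi_trudi_conjugate\<close> is the duality for any two sequences
  with these properties in any commutative ring.

  The duality is an instance of Jacobi's theorem on complementary minors, proved here directly for
  matrices of size \<open>N = m + n\<close>, with rows and columns counted from \<open>0\<close>.
  Let \<open>H\<close> have the first \<open>m\<close> unit vectors as its first \<open>m\<close> rows and the entries
  \<open>r\<close> at \<open>l i + p - m - i\<close>, \<open>p < N\<close>, in row \<open>m + i\<close>; let \<open>E\<close> be the unitriangular
  matrix with entries \<open>(-1)\<close> to the power \<open>q - p\<close> times \<open>c\<close> at \<open>q - p\<close>. Then \<open>det H\<close> is the determinant in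
  \<open>r\<close> and \<open>det E = 1\<close>. By the convolution identity, row \<open>m + i\<close> of \<open>H E\<close> is the unit vector
  at \<open>m + i - l i\<close>, while its first \<open>m\<close> rows are those of \<open>E\<close>. The columns of \<open>H E\<close> without such a unit
  entry are the numbers \<open>l' j + m - 1 - j\<close>, \<open>j < m\<close>, where \<open>l'\<close> is the conjugate of \<open>l\<close>
  (\<open>conjugate_shuffle_permutes\<close>). So \<open>det (H E)\<close> is, up to the sign of the permutation of columns, a minor
  of \<open>E\<close>, and this minor is, up to a sign, the determinant in \<open>c\<close>. Both signs are
  \<open>-1\<close> to the power \<open>|l|\<close>: for the permutation this is \<open>sign_shuffle\<close>.
\<close>

section \<open>Formal infinite products\<close>

lemma has_formal_prod_1: "has_formal_prod (\<lambda>_. 1) 1"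
  by (simp add: has_formal_prod_def)

lemma has_formal_prod_mult:
  assumes "has_formal_prod F P" "has_formal_prod G Q"
  shows "has_formal_prod (\<lambda>i. F i * G i) (P * Q)"
  unfolding has_formal_prod_def
proof (intro allI)
  fix n m
  have "\<forall>\<^sub>F I in finite_subsets_at_top UNIV. \<forall>k\<in>{0..n}. \<forall>w\<in>monomial_splits m.
      mps_coeff (fps_nth (prod F I) k) (fst w) = mps_coeff (fps_nth P k) (fst w) \<and>
      mps_coeff (fps_nth (prod G I) (n - k)) (snd w) = mps_coeff (fps_nth Q (n - k)) (snd w)"
    using assms by (intro eventually_ball_finite ballI eventually_conj)
      (auto simp: has_formal_prod_def)
  then show "\<forall>\<^sub>F I in finite_subsets_at_top UNIV.
      mps_coeff (fps_nth (\<Prod>i\<in>I. F i * G i) n) m = mps_coeff (fps_nth (P * Q) n) m"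
  proof eventually_elim
    case (elim I)
    then show ?case
      by (auto simp: prod.distrib fps_mult_nth mps_coeff_mult case_prod_beta intro!: sum.cong)
  qed
qed

text \<open>
  Substituting \<open>-z\<close> only changes the signs of the odd coefficients, and is therefore multiplicative
  over every commutative ring, zero divisors or not.
\<close>

lemma fps_mult_compose_uminus_X:
  fixes a b :: "'a :: comm_ring_1 fps"
  shows "a * b oo - fps_X = (a oo - fps_X) * (b oo - fps_X)"
proof (rule fps_ext)
  fix n
  have "(- 1) ^ n * (fps_nth a k * fps_nth b (n - k)) =
      ((- 1) ^ k * fps_nth a k) * ((- 1) ^ (n - k) * fps_nth b (n - k))" if "k \<le> n" for k
  proof -
    have "(- 1 :: 'a) ^ n = (- 1) ^ k * (- 1) ^ (n - k)"
      using that by (simp add: power_add [symmetric])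
    then show ?thesis by (simp add: ac_simps)
  qed
  then show "fps_nth (a * b oo - fps_X) n = fps_nth ((a oo - fps_X) * (b oo - fps_X)) n"
    by (simp add: fps_compose_uminus' fps_mult_nth sum_distrib_left)
qed

lemma fps_prod_compose_uminus_X:
  fixes F :: "'b \<Rightarrow> 'a :: comm_ring_1 fps"
  shows "prod F I oo - fps_X = (\<Prod>i\<in>I. F i oo - fps_X)"
  by (induction I rule: infinite_finite_induct) (simp_all add: fps_mult_compose_uminus_X)

lemma mps_coeff_neg_one_power_mult:
  "mps_coeff ((- 1) ^ n * p) m = (- 1) ^ n * mps_coeff p m"
  by (induction n) auto

lemma has_formal_prod_compose_uminus_X:
  assumes "has_formal_prod F P"
  shows "has_formal_prod (\<lambda>i. F i oo - fps_X) (P oo - fps_X)"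
  unfolding has_formal_prod_def
proof (intro allI)
  fix n m
  from assms have "\<forall>\<^sub>F I in finite_subsets_at_top UNIV.
      mps_coeff (fps_nth (prod F I) n) m = mps_coeff (fps_nth P n) m"
    by (simp add: has_formal_prod_def)
  then show "\<forall>\<^sub>F I in finite_subsets_at_top UNIV.
      mps_coeff (fps_nth (\<Prod>i\<in>I. F i oo - fps_X) n) m = mps_coeff (fps_nth (P oo - fps_X) n) m"
    unfolding fps_prod_compose_uminus_X [symmetric]
    by eventually_elim (simp add: fps_compose_uminus' mps_coeff_neg_one_power_mult)
qed

section \<open>The convolution identity of the two families\<close>

lemma mps_fps_of_fps_compose_uminus_X:
  "mps_fps_of_fps (f oo - fps_X) oo - fps_X = mps_fps_of_fps f"
proof -
  have "(- 1) ^ n * mps_const ((- 1) ^ n * fps_nth f n) = mps_const (fps_nth f n)" for n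
    by (rule mps_eqI) (simp add: mps_coeff_neg_one_power_mult mps_const_def mult.assoc [symmetric]
        flip: power_mult_distrib)
  then show ?thesis
    by (intro fps_ext) (simp add: fps_compose_uminus' mps_fps_of_fps_def)
qed

lemma linear_factor_compose_uminus_X:
  "linear_factor (f oo - fps_X) i oo - fps_X = linear_factor f i"
proof -
  have "fps_const c oo - fps_X = (fps_const c :: rat mps fps)" for c
    by (rule fps_ext) (simp add: fps_compose_uminus')
  moreover have "(1 oo - fps_X) = (1 :: rat mps fps)"
    by (rule fps_ext) (simp add: fps_compose_uminus')
  ultimately show ?thesis
    by (simp add: linear_factor_def fps_compose_sub_distrib fps_mult_compose_uminus_X
        mps_fps_of_fps_compose_uminus_X)
qed

lemma generating_functions_mult:
  assumes "delta_series f" "is_r_family f r" "is_c_family f c"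
  shows "mps_fps_of_symfuns r * (mps_fps_of_symfuns c oo - fps_X) = 1"
proof -
  have f0: "fps_nth f 0 = 0" using assms(1) by (simp add: delta_series_def)
  have "has_formal_prod (linear_factor f) (mps_fps_of_symfuns c oo - fps_X)"
    using has_formal_prod_compose_uminus_X [OF assms(3) [unfolded is_c_family_def]]
    by (simp add: linear_factor_compose_uminus_X)
  with assms(2) have "has_formal_prod (\<lambda>i. inv_linear_factor f i * linear_factor f i)
      (mps_fps_of_symfuns r * (mps_fps_of_symfuns c oo - fps_X))"
    unfolding is_r_family_def by (intro has_formal_prod_mult)
  moreover have "inv_linear_factor f i * linear_factor f i = 1" for i
    using linear_factor_mult_inv [OF f0, of i] by (simp add: mult.commute)
  ultimately have "has_formal_prod (\<lambda>_. 1) (mps_fps_of_symfuns r * (mps_fps_of_symfuns c oo - fps_X))"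
    by simp
  then show ?thesis
    by (rule has_formal_prod_unique [OF _ has_formal_prod_1])
qed

lemma mps_of_symfun_sum: "mps_of_symfun (sum g A) = (\<Sum>x\<in>A. mps_of_symfun (g x))"
  by (induction A rule: infinite_finite_induct)
    (simp_all add: zero_symfun.rep_eq plus_symfun.rep_eq)

lemma mps_of_symfun_neg_one_power: "mps_of_symfun ((- 1) ^ n) = (- 1) ^ n"
  by (induction n) (simp_all add: uminus_symfun.rep_eq one_symfun.rep_eq)

lemma sum_r_family_c_family:
  assumes "delta_series f" "is_r_family f r" "is_c_family f c"
  shows "(\<Sum>k\<le>d. r k * ((- 1) ^ (d - k) * c (d - k))) = (if d = 0 then 1 else 0)"
proof -
  have "fps_nth (mps_fps_of_symfuns r * (mps_fps_of_symfuns c oo - fps_X)) d =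
      (if d = 0 then 1 else 0)"
    by (simp add: generating_functions_mult [OF assms])
  then have "mps_of_symfun (\<Sum>k\<le>d. r k * ((- 1) ^ (d - k) * c (d - k))) =
      mps_of_symfun (if d = 0 then 1 else 0)"
    by (simp add: fps_mult_nth mps_fps_of_symfuns_def fps_compose_uminus' mps_of_symfun_sum
        times_symfun.rep_eq mps_of_symfun_neg_one_power one_symfun.rep_eq zero_symfun.rep_eq
        atMost_atLeast0)
  then show ?thesis by (simp add: mps_of_symfun_inject)
qed

text \<open>Every factor of the product has constant term \<open>1\<close> in \<open>z\<close>.\<close>

lemma c_family_0:
  assumes "delta_series f" "is_c_family f c"
  shows "c 0 = 1"
proof -
  have "fps_nth (linear_factor (f oo - fps_X) i) 0 = 1" for i
    using assms(1) by (simp add: delta_series_def linear_factor_def mps_fps_of_fps_def)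
  then have "fps_nth (prod (linear_factor (f oo - fps_X)) I) 0 = 1" for I
    by (induction I rule: infinite_finite_induct) simp_all
  then have "mps_coeff (mps_of_symfun (c 0)) m = mps_coeff 1 m" for m
    using assms(2) [unfolded is_c_family_def has_formal_prod_def, rule_format, of 0 m]
    by (simp add: eventually_const_iff mps_fps_of_symfuns_def)
  then have "mps_of_symfun (c 0) = mps_of_symfun 1"
    by (intro mps_eqI) (simp add: one_symfun.rep_eq)
  then show ?thesis by (simp add: mps_of_symfun_inject)
qed


section \<open>Determinants\<close>

lemma det_mat_transpose:
  "det (mat n n (\<lambda>(i, j). f j i)) = det (mat n n (\<lambda>(i, j). f i j))"
proof -
  have "mat n n (\<lambda>(i, j). f j i) = transpose_mat (mat n n (\<lambda>(i, j). f i j))"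
    by (rule eq_matI) auto
  then show ?thesis by (simp add: det_transpose [of _ n])
qed

lemma det_mat_permute_rows:
  assumes p: "p permutes {0..<n}"
  shows "det (mat n n (\<lambda>(i, j). f (p i) j)) = signof p * det (mat n n (\<lambda>(i, j). f i j))"
proof -
  have "mat n n (\<lambda>(i, j). f (p i) j) = mat n n (\<lambda>(i, j). mat n n (\<lambda>(i, j). f i j) $$ (p i, j))"
    using permutes_in_image [OF p] by (intro eq_matI) auto
  then show ?thesis
    using det_permute_rows [OF _ p, of "mat n n (\<lambda>(i, j). f i j)"] by simp
qed

lemma det_mat_permute_cols:
  assumes p: "p permutes {0..<n}"
  shows "det (mat n n (\<lambda>(i, j). f i (p j))) = signof p * det (mat n n (\<lambda>(i, j). f i j))"
  using det_mat_permute_rows [OF p, of "\<lambda>i j. f j i"]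
  by (simp add: det_mat_transpose [of n f] det_mat_transpose [of n "\<lambda>i j. f i (p j)"])

lemma det_mat_reverse:
  "det (mat n n (\<lambda>(i, j). f (n - 1 - i) (n - 1 - j))) = det (mat n n (\<lambda>(i, j). f i j))"
proof -
  define p where "p i = (if i < n then n - 1 - i else i)" for i
  have p: "p permutes {0..<n}"
    by (rule bij_imp_permutes, rule bij_betw_byWitness [where f' = p]) (auto simp: p_def)
  have "mat n n (\<lambda>(i, j). f (n - 1 - i) (n - 1 - j)) = mat n n (\<lambda>(i, j). f (p i) (p j))"
    by (rule eq_matI) (auto simp: p_def)
  then show ?thesis
    by (simp add: det_mat_permute_rows [OF p, of "\<lambda>i j. f i (p j)"] det_mat_permute_cols [OF p]
        mult.assoc [symmetric] flip: of_int_mult)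
qed

lemma det_mat_scale:
  fixes x y :: "nat \<Rightarrow> 'a :: comm_ring_1"
  shows "det (mat n n (\<lambda>(i, j). x i * y j * f i j)) =
    prod x {0..<n} * prod y {0..<n} * det (mat n n (\<lambda>(i, j). f i j))"
proof -
  have "(\<Prod>i = 0..<n. x i * y (p i) * f i (p i)) =
      prod x {0..<n} * prod y {0..<n} * (\<Prod>i = 0..<n. f i (p i))" if "p permutes {0..<n}" for p
    using prod.permute [OF that, of y] by (simp add: prod.distrib comp_def)
  moreover have "p i < n" if "p permutes {0..<n}" "i < n" for p i
    using permutes_in_image [OF that(1), of i] that(2) by simp
  ultimately show ?thesis
    by (simp add: det_def sum_distrib_left mult.left_commute)
qed

text \<open>
  Unit rows at the bottom or at the top can be deleted together with their columns. One row is
  deleted at a time, as the last column of the transpose; this works over every commutative ring.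
\<close>

lemma det_mat_trailing_unit_rows:
  fixes f :: "nat \<Rightarrow> nat \<Rightarrow> 'a :: comm_ring_1"
  assumes "\<And>i j. k \<le> i \<Longrightarrow> i < k + m \<Longrightarrow> j < k + m \<Longrightarrow> f i j = (if i = j then 1 else 0)"
  shows "det (mat (k + m) (k + m) (\<lambda>(i, j). f i j)) = det (mat k k (\<lambda>(i, j). f i j))"
  using assms
proof (induction m)
  case 0
  then show ?case by simp
next
  case (Suc m)
  define N where "N = k + m"
  have "mat (Suc N) (Suc N) (\<lambda>(i, j). f j i) =
      four_block_mat (mat N N (\<lambda>(i, j). f j i)) (0\<^sub>m N 1) (mat 1 N (\<lambda>(i, j). f j N)) (1\<^sub>m 1)"
    using Suc.prems by (intro eq_matI) (auto simp: N_def less_Suc_eq)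
  then have "det (mat (Suc N) (Suc N) (\<lambda>(i, j). f j i)) = det (mat N N (\<lambda>(i, j). f j i))"
    by (simp add: det_four_block_mat_upper_right_zero_col [of _ N])
  also have "\<dots> = det (mat N N (\<lambda>(i, j). f i j))" by (rule det_mat_transpose)
  also have "\<dots> = det (mat k k (\<lambda>(i, j). f i j))"
    unfolding N_def using Suc by simp
  finally show ?case
    by (simp add: N_def det_mat_transpose [of _ f])
qed

lemma det_mat_leading_unit_rows:
  fixes f :: "nat \<Rightarrow> nat \<Rightarrow> 'a :: comm_ring_1"
  assumes "\<And>i j. i < m \<Longrightarrow> j < m + n \<Longrightarrow> f i j = (if i = j then 1 else 0)"
  shows "det (mat (m + n) (m + n) (\<lambda>(i, j). f i j)) = det (mat n n (\<lambda>(i, j). f (m + i) (m + j)))"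
proof -
  have "det (mat (m + n) (m + n) (\<lambda>(i, j). f i j)) =
      det (mat (n + m) (n + m) (\<lambda>(i, j). f (n + m - 1 - i) (n + m - 1 - j)))"
    using det_mat_reverse [of "m + n" f] by (simp add: add.commute)
  also have "\<dots> = det (mat n n (\<lambda>(i, j). f (n + m - 1 - i) (n + m - 1 - j)))"
    by (rule det_mat_trailing_unit_rows) (auto simp: assms)
  also have "\<dots> = det (mat n n (\<lambda>(i, j). f (m + (n - 1 - i)) (m + (n - 1 - j))))"
    by (intro arg_cong [where f = det] eq_matI) (auto simp: add.commute)
  also have "\<dots> = det (mat n n (\<lambda>(i, j). f (m + i) (m + j)))"
    by (rule det_mat_reverse [where f = "\<lambda>i j. f (m + i) (m + j)"])
  finally show ?thesis .
qed


section \<open>The sign of a shuffle\<close>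

text \<open>
  The exponent is the number of inversions of \<open>\<pi>\<close>. The induction lowers it by one: an
  adjacent pair of values \<open>p\<close>, \<open>p + 1\<close>, of which the larger is taken in the first block and the smaller
  in the second, is exchanged, and both blocks stay increasing.
\<close>

lemma sign_shuffle:
  assumes "\<pi> permutes {0..<m + n}"
    and "\<And>a b. a < b \<Longrightarrow> b < m \<Longrightarrow> \<pi> a < \<pi> b"
    and "\<And>a b. m \<le> a \<Longrightarrow> a < b \<Longrightarrow> b < m + n \<Longrightarrow> \<pi> a < \<pi> b"
  shows "sign \<pi> = (- 1) ^ (\<Sum>q<m. \<pi> q - q)"
  using assms
proof (induction "\<Sum>q<m. \<pi> q - q" arbitrary: \<pi>)
  case 0
  note perm = "0.prems"(1)
  have ge: "q \<le> \<pi> q" if "q < m" for q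
    using that
  proof (induction q)
    case (Suc q)
    then have "q \<le> \<pi> q" "\<pi> q < \<pi> (Suc q)" using "0.prems"(2) by simp_all
    then show ?case by simp
  qed simp
  have first: "\<pi> q = q" if "q < m" for q
    using ge [OF that] 0(1) that by (simp add: order_antisym)
  have "\<pi> k = k" if "k < m + n" for k
    using that
  proof (induction k rule: less_induct)
    case (less k)
    show ?case
    proof (cases "k < m")
      case False
      have "\<not> \<pi> k < k"
        using less permutes_inj [OF perm] by (metis inj_eq less_irrefl less_trans)
      moreover have "\<not> k < \<pi> k"
      proof
        assume "k < \<pi> k"
        have "k \<in> \<pi> ` {0..<m + n}" using permutes_image [OF perm] less.prems by simp
        then obtain j where j: "j < m + n" "\<pi> j = k" by auto
        then have "\<not> j < k" using less by force
        then show False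
          using "0.prems"(3) [of k j] False j \<open>k < \<pi> k\<close> by (cases "j = k") auto
      qed
      ultimately show ?thesis by simp
    qed (rule first)
  qed
  then have "\<pi> = id"
    using permutes_not_in [OF perm] by (intro ext) (metis atLeastLessThan_iff id_apply zero_le)
  with 0(1) show ?case by simp
next
  case (Suc d)
  note perm = Suc.prems(1) and mono1 = Suc.prems(2) and mono2 = Suc.prems(3)
  have inj: "\<pi> a = \<pi> b \<longleftrightarrow> a = b" for a b
    using permutes_inj [OF perm] by (simp add: inj_eq)
  have "\<exists>q. q < m \<and> q < \<pi> q"
  proof (rule ccontr)
    assume "\<nexists>q. q < m \<and> q < \<pi> q"
    then have "\<pi> a - a = 0" if "a < m" for a
      using that by (metis diff_is_0_eq not_less)
    then have "(\<Sum>q<m. \<pi> q - q) = 0" by simp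
    with Suc(2) show False by simp
  qed
  \<comment> \<open>
    Since \<open>q\<close> is the first position that is moved up, all earlier values are less than \<open>q\<close>, and
    the later ones in the first block exceed \<open>\<pi> q\<close>. So the value just below \<open>\<pi> q\<close> is taken in the
    second block.
  \<close>
  then obtain q where q: "q < m" "q < \<pi> q" and least: "\<And>a. a < q \<Longrightarrow> \<not> (a < m \<and> a < \<pi> a)"
    using exists_least_iff [of "\<lambda>q. q < m \<and> q < \<pi> q"] by blast
  define p where "p = \<pi> q - 1"
  have p: "\<pi> q = Suc p" "q \<le> p" using q by (simp_all add: p_def)
  have pN: "Suc p < m + n"
    using permutes_in_image [OF perm, of q] q p by simp
  then have "p \<in> \<pi> ` {0..<m + n}" using permutes_image [OF perm] by simp
  then obtain j where j: "j < m + n" "\<pi> j = p" by auto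
  have "m \<le> j"
  proof (rule ccontr)
    assume "\<not> m \<le> j"
    then show False
      using least [of j] mono1 [of q j] j p by (cases j q rule: linorder_cases) auto
  qed
  define \<sigma> where "\<sigma> = transpose p (Suc p) \<circ> \<pi>"
  have \<sigma>_q: "\<sigma> q = p" and \<sigma>_j: "\<sigma> j = Suc p" by (simp_all add: \<sigma>_def p j)
  have \<sigma>_other: "\<sigma> a = \<pi> a" if "a \<noteq> q" "a \<noteq> j" for a
    using that inj [of a q] inj [of a j] by (simp add: \<sigma>_def p j transpose_def)
  have \<sigma>_perm: "\<sigma> permutes {0..<m + n}"
    unfolding \<sigma>_def using pN by (intro permutes_compose [OF perm] permutes_swap_id) auto
  have le: "\<pi> a \<noteq> p" if "a \<noteq> j" for a using that j inj by metis
  have le': "\<pi> a \<noteq> Suc p" if "a \<noteq> q" for a using that p inj by metis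
  have sum: "(\<Sum>a<m. \<pi> a - a) = Suc (\<Sum>a<m. \<sigma> a - a)"
  proof -
    have "(\<Sum>a\<in>{..<m} - {q}. \<pi> a - a) = (\<Sum>a\<in>{..<m} - {q}. \<sigma> a - a)"
      using \<open>m \<le> j\<close> by (intro sum.cong) (auto simp: \<sigma>_other)
    moreover have "\<pi> q - q = Suc (\<sigma> q - q)" using p by (simp add: \<sigma>_q)
    ultimately show ?thesis
      using q by (simp add: sum.remove [of "{..<m}" q])
  qed
  have "sign \<sigma> = (- 1) ^ (\<Sum>a<m. \<sigma> a - a)"
  proof (rule Suc(1) [OF _ \<sigma>_perm])
    show "d = (\<Sum>a<m. \<sigma> a - a)" using sum Suc(2) by simp
    show "\<sigma> a < \<sigma> b" if "a < b" "b < m" for a b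
      using mono1 [OF that] that \<open>m \<le> j\<close> p le [of a]
      by (cases "a = q"; cases "b = q") (auto simp: \<sigma>_q \<sigma>_other)
    show "\<sigma> a < \<sigma> b" if "m \<le> a" "a < b" "b < m + n" for a b
      using mono2 [OF that] that q j le' [of b]
      by (cases "a = j"; cases "b = j") (auto simp: \<sigma>_j \<sigma>_other)
  qed
  moreover have "sign \<sigma> = - sign \<pi>"
    unfolding \<sigma>_def using permutes_imp_permutation [OF _ perm]
    by (subst sign_compose) (simp_all add: sign_swap_id permutation_swap_id)
  ultimately show ?case by (simp add: sum)
qed


section \<open>Conjugate partitions\<close>

lemma finite_down_closed_eq_lessThan_card:
  fixes S :: "nat set"
  assumes "finite S" "\<And>a b. a \<le> b \<Longrightarrow> b \<in> S \<Longrightarrow> a \<in> S"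
  shows "S = {..<card S}"
proof (rule Set.set_eqI, rule iffI)
  fix x assume "x \<in> S"
  then have "{..x} \<subseteq> S" using assms(2) by auto
  then have "card {..x} \<le> card S" by (rule card_mono [OF assms(1)])
  then show "x \<in> {..<card S}" by simp
next
  fix x assume x: "x \<in> {..<card S}"
  show "x \<in> S"
  proof (rule ccontr)
    assume "x \<notin> S"
    then have "S \<subseteq> {..<x}" using assms(2) by (meson lessThan_iff not_less subsetI)
    then have "card S \<le> x" using card_mono [of "{..<x}" S] by simp
    with x show False by simp
  qed
qed

lemma less_conjugate_partition_iff:
  assumes "is_partition l"
  shows "i < conjugate_partition l j \<longleftrightarrow> j < l i"
proof -
  have "{i. j < l i} = {..<card {i. j < l i}}"
  proof (rule finite_down_closed_eq_lessThan_card)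
    show "finite {i. j < l i}"
      using assms unfolding is_partition_def by (auto elim: rev_finite_subset)
    show "a \<in> {i. j < l i}" if "a \<le> b" "b \<in> {i. j < l i}" for a b
      using assms that unfolding is_partition_def
      by (metis antimonoD le_less_trans mem_Collect_eq not_le)
  qed
  then show ?thesis unfolding conjugate_partition_def by blast
qed

lemma num_parts_eq_conjugate_partition_0: "num_parts l = conjugate_partition l 0"
  by (simp add: num_parts_def conjugate_partition_def)

lemma num_parts_conjugate_partition:
  assumes "is_partition l"
  shows "num_parts (conjugate_partition l) = l 0"
proof -
  have "{j. conjugate_partition l j \<noteq> 0} = {..<l 0}"
    using less_conjugate_partition_iff [OF assms, of 0] by auto
  then show ?thesis by (simp add: num_parts_def)
qed

lemma antimono_conjugate_partition:
  assumes "is_partition l"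
  shows "antimono (conjugate_partition l)"
proof (rule antimonoI)
  fix j k :: nat assume "j \<le> k"
  then have "i < conjugate_partition l k \<Longrightarrow> i < conjugate_partition l j" for i
    using less_conjugate_partition_iff [OF assms] by (meson le_less_trans)
  then show "conjugate_partition l k \<le> conjugate_partition l j"
    by (meson leI less_irrefl)
qed

text \<open>
  For a partition \<open>l\<close> with at most \<open>n\<close> nonzero parts, none of them above \<open>m\<close>, this is the
  permutation of \<open>{0..<m + n}\<close> that sends \<open>m + i\<close> to \<open>m + i - l i\<close> for \<open>i < n\<close> and lists the
  remaining values in increasing order on \<open>{0..<m}\<close>. Here \<open>m - 1 - j\<close> is sent to
  \<open>l' j + (m - 1 - j)\<close>, where \<open>l'\<close> is the conjugate of \<open>l\<close>; counting \<open>j\<close> downwards makes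
  the permutation increasing on both blocks, and the identity if \<open>l\<close> is empty. It is the identity
  outside \<open>{0..<m + n}\<close>.
\<close>

definition conjugate_shuffle :: "(nat \<Rightarrow> nat) \<Rightarrow> nat \<Rightarrow> nat \<Rightarrow> nat \<Rightarrow> nat" where
  "conjugate_shuffle l m n p =
     (if p < m then conjugate_partition l (m - 1 - p) + p
      else if p < m + n then p - l (p - m) else p)"

context
  fixes l :: "nat \<Rightarrow> nat" and m n :: nat
  assumes l: "is_partition l" and n: "num_parts l \<le> n"
    and m: "num_parts (conjugate_partition l) \<le> m"
begin

lemma part_le: "l i \<le> m"
  using l m num_parts_conjugate_partition [OF l] antimonoD [of l 0 i] by (simp add: is_partition_def)

lemma conjugate_part_le: "conjugate_partition l j \<le> n"
  using n antimonoD [OF antimono_conjugate_partition [OF l], of 0 j]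
  by (simp add: num_parts_eq_conjugate_partition_0)

lemma conjugate_shuffle_mono1:
  assumes "a < b" "b < m"
  shows "conjugate_shuffle l m n a < conjugate_shuffle l m n b"
proof -
  have "conjugate_partition l (m - 1 - a) \<le> conjugate_partition l (m - 1 - b)"
    using assms by (intro antimonoD [OF antimono_conjugate_partition [OF l]]) simp
  with assms show ?thesis by (simp add: conjugate_shuffle_def)
qed

lemma conjugate_shuffle_mono2:
  assumes "m \<le> a" "a < b" "b < m + n"
  shows "conjugate_shuffle l m n a < conjugate_shuffle l m n b"
proof -
  have "l (b - m) \<le> l (a - m)"
    using assms l by (intro antimonoD [of l]) (simp_all add: is_partition_def)
  with assms part_le [of "a - m"] show ?thesis
    by (simp add: conjugate_shuffle_def)
qed

text \<open>
  The value in the first block is the smaller one or the larger one according to whether the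
  box \<open>(i, j)\<close>, with \<open>i = b - m\<close> and \<open>j = m - 1 - a\<close>, lies outside or inside the diagram of \<open>l\<close>.
\<close>

lemma conjugate_shuffle_disjoint:
  assumes "a < m" "m \<le> b" "b < m + n"
  shows "conjugate_shuffle l m n a \<noteq> conjugate_shuffle l m n b"
proof (cases "m - 1 - a < l (b - m)")
  case True
  then have "b - m < conjugate_partition l (m - 1 - a)"
    by (simp add: less_conjugate_partition_iff [OF l])
  with True show ?thesis
    using assms by (simp add: conjugate_shuffle_def)
next
  case False
  then have "conjugate_partition l (m - 1 - a) \<le> b - m"
    using less_conjugate_partition_iff [OF l] by (meson not_less)
  with False show ?thesis
    using assms by (simp add: conjugate_shuffle_def)
qed

lemma conjugate_shuffle_permutes: "conjugate_shuffle l m n permutes {0..<m + n}"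
proof (rule bij_imp_permutes)
  let ?\<pi> = "conjugate_shuffle l m n"
  have "?\<pi> a \<noteq> ?\<pi> b" if "a < b" "b < m + n" for a b
    using that conjugate_shuffle_mono1 [of a b] conjugate_shuffle_mono2 [of a b]
      conjugate_shuffle_disjoint [of a b]
    by (cases "b < m"; cases "a < m") auto
  then have inj: "inj_on ?\<pi> {0..<m + n}"
    by (intro linorder_inj_onI) auto
  have "?\<pi> p < m + n" if "p < m + n" for p
    using that conjugate_part_le [of "m - 1 - p"] by (auto simp: conjugate_shuffle_def)
  then have "?\<pi> ` {0..<m + n} \<subseteq> {0..<m + n}" by auto
  then show "bij_betw ?\<pi> {0..<m + n} {0..<m + n}"
    using inj by (simp add: bij_betw_def endo_inj_surj)
qed (simp add: conjugate_shuffle_def)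

lemma sign_conjugate_shuffle:
  "sign (conjugate_shuffle l m n) = (- 1) ^ (\<Sum>j<m. conjugate_partition l j)"
proof -
  have "(\<Sum>q<m. conjugate_shuffle l m n q - q) = (\<Sum>q<m. conjugate_partition l (m - Suc q))"
    by (intro sum.cong) (simp_all add: conjugate_shuffle_def)
  also have "\<dots> = (\<Sum>j<m. conjugate_partition l j)"
    by (rule sum.nat_diff_reindex)
  finally show ?thesis
    using sign_shuffle [OF conjugate_shuffle_permutes conjugate_shuffle_mono1 conjugate_shuffle_mono2]
    by simp
qed


section \<open>Duality of the Jacobi-Trudi determinants\<close>

text \<open>
  In the proof, \<open>h\<close> and \<open>e\<close> are the entries of the matrices \<open>H\<close> and \<open>E\<close> of the introduction, and
  \<open>he\<close> those of their product. The sign in \<open>e\<close> has exponent \<open>p + q\<close>, of the same parity as \<open>q - p\<close>,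
  to avoid subtraction of natural numbers.
\<close>

lemma jacobi_trudi_conjugate:
  fixes r c :: "nat \<Rightarrow> 'a :: comm_ring_1"
  assumes c0: "c 0 = 1"
    and conv: "\<And>d. (\<Sum>k\<le>d. r k * ((- 1) ^ (d - k) * c (d - k))) = (if d = 0 then 1 else 0)"
  shows "jacobi_trudi r l n = jacobi_trudi c (conjugate_partition l) m"
proof -
  define \<pi> where "\<pi> = conjugate_shuffle l m n"
  define l' where "l' = conjugate_partition l"
  define s where "s = (\<Sum>j<m. l' j)"
  define h where "h i p = (if i < m then if i = p then 1 else 0
    else extend_by_zero r (int (l (i - m)) + int p - int i))" for i p
  define e where "e p q = (- 1) ^ (p + q) * extend_by_zero c (int q - int p)" for p q
  define N where "N = m + n"
  define he where "he i q = (\<Sum>p<N. h i p * e p q)" for i q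
  have perm: "\<pi> permutes {0..<N}"
    unfolding \<pi>_def N_def by (rule conjugate_shuffle_permutes)
  have sign: "signof \<pi> = (- 1 :: 'a) ^ s"
    unfolding \<pi>_def s_def l'_def by (simp add: sign_conjugate_shuffle)

  have det_h: "det (mat N N (\<lambda>(i, j). h i j)) = jacobi_trudi r l n"
  proof -
    have "det (mat N N (\<lambda>(i, j). h i j)) = det (mat n n (\<lambda>(i, j). h (m + i) (m + j)))"
      unfolding N_def by (rule det_mat_leading_unit_rows) (simp add: h_def)
    also have "\<dots> = jacobi_trudi r l n"
      unfolding jacobi_trudi_def
      by (intro arg_cong [where f = det] eq_matI) (simp_all add: h_def add_diff_eq)
    finally show ?thesis .
  qed

  have det_e: "det (mat N N (\<lambda>(i, j). e i j)) = 1"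
  proof -
    have "upper_triangular (mat N N (\<lambda>(i, j). e i j))"
      by (auto simp: e_def extend_by_zero_def)
    then have "det (mat N N (\<lambda>(i, j). e i j)) = prod_list (diag_mat (mat N N (\<lambda>(i, j). e i j)))"
      by (rule det_upper_triangular [OF _ mat_carrier])
    also have "\<dots> = 1"
      by (simp add: prod_list_diag_prod e_def extend_by_zero_def c0)
    finally show ?thesis .
  qed

  have "mat N N (\<lambda>(i, j). he i j) = mat N N (\<lambda>(i, j). h i j) * mat N N (\<lambda>(i, j). e i j)"
    by (rule eq_matI) (simp_all add: he_def scalar_prod_def atLeast0LessThan)
  then have det_he: "det (mat N N (\<lambda>(i, j). he i j)) = jacobi_trudi r l n"
    by (simp add: det_mult [of _ N] det_h det_e)

  have he_top: "he i q = e i q" if "i < m" for i q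
  proof -
    have "he i q = (\<Sum>p<N. if i = p then e p q else 0)"
      unfolding he_def using that by (intro sum.cong) (simp_all add: h_def)
    also have "\<dots> = e i q" using that by (simp add: N_def)
    finally show ?thesis .
  qed

  have he_bottom: "he i q = (if \<pi> i = q then 1 else 0)" if i: "m \<le> i" "i < N" and q: "q < N" for i q
  proof -
    define t where "t = \<pi> i"
    have t: "int t = int i - int (l (i - m))"
      using i part_le [of "i - m"] by (simp add: t_def \<pi>_def N_def conjugate_shuffle_def)
    have summand: "h i p * e p q = (if t \<le> p \<and> p \<le> q
        then r (p - t) * ((- 1) ^ (q - p) * c (q - p)) else 0)" for p
    proof (cases "t \<le> p \<and> p \<le> q")
      case True
      have "h i p = r (p - t)"
        using i t True by (auto simp: h_def extend_by_zero_def nat_diff_distrib'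
            intro!: arg_cong [where f = r])
      moreover have "e p q = (- 1) ^ (q - p) * c (q - p)"
        using True by (auto simp: e_def extend_by_zero_def minus_one_power_iff nat_diff_distrib')
      ultimately show ?thesis using True by simp
    next
      case False
      then have "h i p = 0 \<or> e p q = 0"
        using i t by (auto simp: h_def e_def extend_by_zero_def)
      with False show ?thesis by auto
    qed
    show ?thesis
    proof (cases "t \<le> q")
      case True
      have "he i q = (\<Sum>p\<in>{t..q}. r (p - t) * ((- 1) ^ (q - p) * c (q - p)))"
        unfolding he_def summand using q by (intro sum.mono_neutral_cong_right) auto
      also have "\<dots> = (\<Sum>k\<le>q - t. r k * ((- 1) ^ (q - t - k) * c (q - t - k)))"
        using True by (intro sum.reindex_bij_witness [where i = "\<lambda>k. k + t" and j = "\<lambda>p. p - t"])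
          (auto simp: add.commute)
      also have "\<dots> = (if t = q then 1 else 0)"
        unfolding conv using True by simp
      finally show ?thesis by (simp add: t_def)
    next
      case False
      then have "he i q = 0" unfolding he_def summand by (intro sum.neutral) auto
      with False show ?thesis by (simp add: t_def)
    qed
  qed

  \<comment> \<open>
    With the columns permuted by \<open>\<pi>\<close> the bottom rows become unit rows on the diagonal. What remains
    is the determinant in \<open>c\<close>, with the order of rows and columns reversed, transposed, and with
    signs in rows and columns.
  \<close>
  have "(- 1) ^ s * jacobi_trudi r l n = det (mat N N (\<lambda>(i, j). he i (\<pi> j)))"
    by (simp add: det_mat_permute_cols [OF perm] det_he sign)
  also have "\<dots> = det (mat m m (\<lambda>(i, j). he i (\<pi> j)))"
    unfolding N_def
  proof (rule det_mat_trailing_unit_rows)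
    fix i j assume "m \<le> i" "i < m + n" "j < m + n"
    then show "he i (\<pi> j) = (if i = j then 1 else 0)"
      using he_bottom [of i "\<pi> j"] permutes_in_image [OF perm, of j] permutes_inj [OF perm]
      by (simp add: N_def inj_eq)
  qed
  also have "\<dots> = det (mat m m (\<lambda>(i, j). he (m - 1 - i) (\<pi> (m - 1 - j))))"
    by (rule det_mat_reverse [symmetric, where f = "\<lambda>i j. he i (\<pi> j)"])
  also have "\<dots> = det (mat m m (\<lambda>(i, j). he (m - 1 - j) (\<pi> (m - 1 - i))))"
    by (rule det_mat_transpose)
  also have "\<dots> = det (mat m m (\<lambda>(i, j). (- 1) ^ (l' i + i) * (- 1) ^ j *
      extend_by_zero c (int (l' i) + int j - int i)))"
  proof -
    have "he (m - 1 - j) (\<pi> (m - 1 - i)) = (- 1) ^ (l' i + i) * (- 1) ^ j *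
        extend_by_zero c (int (l' i) + int j - int i)" if "i < m" "j < m" for i j
    proof -
      have \<pi>: "\<pi> (m - 1 - i) = l' i + (m - 1 - i)"
        using that by (simp add: \<pi>_def conjugate_shuffle_def l'_def)
      have "he (m - 1 - j) (\<pi> (m - 1 - i)) =
          (- 1) ^ (m - 1 - j + (l' i + (m - 1 - i))) *
          extend_by_zero c (int (l' i + (m - 1 - i)) - int (m - 1 - j))"
        using that by (simp only: he_top [of "m - 1 - j"] \<pi> e_def)
      moreover have "int (l' i + (m - 1 - i)) - int (m - 1 - j) = int (l' i) + int j - int i"
        using that by simp
      moreover have "(- 1 :: 'a) ^ (m - 1 - j + (l' i + (m - 1 - i))) = (- 1) ^ (l' i + i) * (- 1) ^ j"
      proof -
        have "m - 1 - j + (l' i + (m - 1 - i)) + (l' i + i + j) = 2 * (l' i + (m - 1))"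
          using that by simp
        then have "even (m - 1 - j + (l' i + (m - 1 - i))) \<longleftrightarrow> even (l' i + i + j)"
          by (metis dvd_triv_left even_add)
        then have "(- 1 :: 'a) ^ (m - 1 - j + (l' i + (m - 1 - i))) = (- 1) ^ (l' i + i + j)"
          by (simp only: minus_one_power_iff)
        then show ?thesis by (simp only: power_add)
      qed
      ultimately show ?thesis
        by (simp only:)
    qed
    then show ?thesis
      by (intro arg_cong [where f = det] eq_matI) simp_all
  qed
  also have "\<dots> = (\<Prod>i=0..<m. (- 1) ^ (l' i + i)) * (\<Prod>j=0..<m. (- 1) ^ j) * jacobi_trudi c l' m"
    unfolding jacobi_trudi_def
    by (rule det_mat_scale [where f = "\<lambda>i j. extend_by_zero c (int (l' i) + int j - int i)"])
  also have "(\<Prod>i=0..<m. (- 1) ^ (l' i + i)) * (\<Prod>j=0..<m. (- 1) ^ j) = (- 1 :: 'a) ^ s"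
  proof -
    have "(\<Prod>i=0..<m. (- 1 :: 'a) ^ (l' i + i)) * (\<Prod>j=0..<m. (- 1) ^ j) =
        (\<Prod>i=0..<m. (- 1) ^ l' i)"
      by (simp add: power_add mult.assoc flip: prod.distrib power_mult_distrib)
    then show ?thesis by (simp add: s_def power_sum atLeast0LessThan)
  qed
  finally have "(- 1) ^ s * ((- 1) ^ s * jacobi_trudi r l n) =
      (- 1) ^ s * ((- 1) ^ s * jacobi_trudi c l' m)"
    by simp
  then show ?thesis
    by (simp add: l'_def mult.assoc [symmetric] flip: power_mult_distrib)
qed

end

theorem mainTheorem2:
  fixes f :: "rat fps" and r c :: "nat \<Rightarrow> symfun" and l :: "nat \<Rightarrow> nat" and n m :: nat
  assumes "delta_series f"
    and "is_r_family f r"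
    and "is_c_family f c"
    and "is_partition l"
    and "n \<ge> num_parts l"
    and "m \<ge> num_parts (conjugate_partition l)"
  shows "jacobi_trudi r l n = jacobi_trudi c (conjugate_partition l) m"
  using assms(4-6) c_family_0 [OF assms(1,3)] sum_r_family_c_family [OF assms(1-3)]
  by (rule jacobi_trudi_conjugate)

end
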